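(* Let $S$ be a finite non-empty set, $p:2^S\to\mathbb{Z}\cup\{-\infty\}$ a supermodular function with $p(\emptyset)=0$ and $p(S)$ finite, and $B=\{x\in\mathbb{R}^S:\widetilde x(S)=p(S),\ \widetilde x(Z)\ge p(Z)\ \forall Z\subseteq S\}$. Let $\{S_1,\dots,S_q\}$, $C_1\subset\cdots\subset C_q=S$ and $\beta_1>\cdots>\beta_q$ be the canonical partition, canonical chain and essential value-sequence defined below. For $i=1,\dots,q$ let $p_i(X)=p(X\cup C_{i-1})-p(C_{i-1})$ for $X\subseteq S_i$, let $B_i=\{x\in\mathbb{R}^{S_i}:\widetilde x(S_i)=p_i(S_i),\ \widetilde x(Z)\ge p_i(Z)\ \forall Z\subseteq S_i\}$ and $T_i=\{x\in\mathbb{R}^{S_i}:\beta_i-1\le x(s)\le\beta_i\ \forall s\in S_i\}$. Then an element $m\in B\cap\mathbb{Z}^S$ is decreasingly minimal in $B\cap\mathbb{Z}^S$ if and only if the restriction $m|S_i$ belongs to $B_i\cap T_i$ for each $i=1,\dots,q$. Equivalently, the set of decreasingly minimal elements of $B\cap\mathbb{Z}^S$ is the set of integral points of the base-polyhedron obtained as the direct sum of the $B_i\cap T_i$.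
   Context: $\widetilde x(Z)=\sum_{s\in Z}x(s)$. Canonical partition: set $C_0=\emptyset$. Iteratively, for $j=1,2,\dots$, while $C_{j-1}\ne S$: let $p'_{j-1}(X)=p(X\cup C_{j-1})-p(C_{j-1})$ for $X\subseteq S-C_{j-1}$; let $\beta_j=\max\{\lceil p'_{j-1}(X)/|X|\rceil:\emptyset\ne X\subseteq S-C_{j-1}\}$; let $h_j(X)=p'_{j-1}(X)-(\beta_j-1)|X|$ for $X\subseteq S-C_{j-1}$; let $S_j$ be the smallest maximizer of $h_j$ (the intersection of all its maximizers), and $C_j=C_{j-1}\cup S_j$. When $C_j=S$ set $q=j$. (The $S_j$ are non-empty and $\beta_1>\beta_2>\cdots>\beta_q$.) An element $m$ of a set $Q$ of vectors is decreasingly minimal if, after sorting components in decreasing order, it is lexicographically smaller than or equal to every $y\in Q$ sorted likewise. *)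

theory Defs
  imports "HOL-Library.Extended_Real" "HOL-Library.FuncSet" "HOL-Library.Multiset"
begin

text \<open>
  Vectors in \<open>\<real>\<^sup>S\<close> are the elements of \<open>S \<rightarrow>\<^sub>E UNIV\<close>, those in \<open>\<int>\<^sup>S\<close> the elements of
  \<open>S \<rightarrow>\<^sub>E \<int>\<close>; the restriction \<open>m|S\<^sub>i\<close> is \<^const>\<open>restrict\<close>.
  Set functions take values in \<^typ>\<open>ereal\<close>; the value \<open>\<infinity>\<close> is excluded by
  \<open>int_or_MInf_on\<close>, so \<^typ>\<open>ereal\<close> addition never meets \<open>\<infinity> + -\<infinity>\<close> in
  the inequality below.
\<close>

definition int_or_MInf_on :: "'a set \<Rightarrow> ('a set \<Rightarrow> ereal) \<Rightarrow> bool" where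
  "int_or_MInf_on S p \<longleftrightarrow> (\<forall>X\<subseteq>S. p X = -\<infinity> \<or> (\<exists>k::int. p X = ereal (of_int k)))"

definition supermodular_on :: "'a set \<Rightarrow> ('a set \<Rightarrow> ereal) \<Rightarrow> bool" where
  "supermodular_on S p \<longleftrightarrow>
     (\<forall>X Y. X \<subseteq> S \<longrightarrow> Y \<subseteq> S \<longrightarrow> p X + p Y \<le> p (X \<inter> Y) + p (X \<union> Y))"

definition base_polyhedron :: "'a set \<Rightarrow> ('a set \<Rightarrow> ereal) \<Rightarrow> ('a \<Rightarrow> real) set" where
  "base_polyhedron S p =
     {x \<in> S \<rightarrow>\<^sub>E UNIV. ereal (\<Sum>s\<in>S. x s) = p S \<and> (\<forall>Z\<subseteq>S. ereal (\<Sum>s\<in>Z. x s) \<ge> p Z)}"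

definition is_base_polyhedron :: "'a set \<Rightarrow> ('a \<Rightarrow> real) set \<Rightarrow> bool" where
  "is_base_polyhedron S P \<longleftrightarrow>
     (\<exists>p. int_or_MInf_on S p \<and> supermodular_on S p \<and> p {} = 0 \<and> \<bar>p S\<bar> \<noteq> \<infinity> \<and>
          P = base_polyhedron S p)"

definition direct_sum ::
    "'i set \<Rightarrow> ('i \<Rightarrow> 'a set) \<Rightarrow> ('i \<Rightarrow> ('a \<Rightarrow> real) set) \<Rightarrow> ('a \<Rightarrow> real) set" where
  "direct_sum I A P = {x \<in> (\<Union>i\<in>I. A i) \<rightarrow>\<^sub>E UNIV. \<forall>i\<in>I. restrict x (A i) \<in> P i}"

definition decreasing_list :: "'a set \<Rightarrow> ('a \<Rightarrow> real) \<Rightarrow> real list" where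
  "decreasing_list S x = rev (sorted_list_of_multiset (image_mset x (mset_set S)))"

definition decreasingly_minimal :: "'a set \<Rightarrow> ('a \<Rightarrow> real) set \<Rightarrow> ('a \<Rightarrow> real) \<Rightarrow> bool" where
  "decreasingly_minimal S Q m \<longleftrightarrow>
     m \<in> Q \<and> (\<forall>y\<in>Q. ord_class.lexordp_eq (decreasing_list S m) (decreasing_list S y))"

definition ereal_ceiling :: "ereal \<Rightarrow> ereal" where
  "ereal_ceiling a = (case a of ereal r \<Rightarrow> ereal (of_int \<lceil>r\<rceil>) | PInfty \<Rightarrow> \<infinity> | MInfty \<Rightarrow> -\<infinity>)"

definition contract :: "('a set \<Rightarrow> ereal) \<Rightarrow> 'a set \<Rightarrow> 'a set \<Rightarrow> ereal" where
  "contract p C X = p (X \<union> C) - p C"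

text \<open>One step of the iteration, as a function of the current chain member \<open>C = C\<^sub>j\<^sub>-\<^sub>1\<close>:
  \<open>step_value\<close> is \<open>\<beta>\<^sub>j\<close>, \<open>step_fun\<close> is \<open>h\<^sub>j\<close> and \<open>step_set\<close> is \<open>S\<^sub>j\<close>.\<close>

definition step_value :: "'a set \<Rightarrow> ('a set \<Rightarrow> ereal) \<Rightarrow> 'a set \<Rightarrow> ereal" where
  "step_value S p C =
     Max {ereal_ceiling (contract p C X / ereal (real (card X))) | X. X \<noteq> {} \<and> X \<subseteq> S - C}"

definition step_fun :: "'a set \<Rightarrow> ('a set \<Rightarrow> ereal) \<Rightarrow> 'a set \<Rightarrow> 'a set \<Rightarrow> ereal" where
  "step_fun S p C X = contract p C X - (step_value S p C - 1) * ereal (real (card X))"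

definition step_set :: "'a set \<Rightarrow> ('a set \<Rightarrow> ereal) \<Rightarrow> 'a set \<Rightarrow> 'a set" where
  "step_set S p C =
     \<Inter>{X. X \<subseteq> S - C \<and> (\<forall>Y\<subseteq>S - C. step_fun S p C Y \<le> step_fun S p C X)}"

text \<open>The sequence is continued beyond \<open>q\<close>, where it stays at \<open>S\<close>.\<close>

primrec canonical_chain :: "'a set \<Rightarrow> ('a set \<Rightarrow> ereal) \<Rightarrow> nat \<Rightarrow> 'a set" where
  "canonical_chain S p 0 = {}"
| "canonical_chain S p (Suc j) = canonical_chain S p j \<union> step_set S p (canonical_chain S p j)"

text \<open>The following three are meaningful for \<open>1 \<le> j \<le> canonical_length S p\<close>.\<close>

definition canonical_set :: "'a set \<Rightarrow> ('a set \<Rightarrow> ereal) \<Rightarrow> nat \<Rightarrow> 'a set" where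
  "canonical_set S p j = step_set S p (canonical_chain S p (j - 1))"

definition canonical_value :: "'a set \<Rightarrow> ('a set \<Rightarrow> ereal) \<Rightarrow> nat \<Rightarrow> ereal" where
  "canonical_value S p j = step_value S p (canonical_chain S p (j - 1))"

definition canonical_fun :: "'a set \<Rightarrow> ('a set \<Rightarrow> ereal) \<Rightarrow> nat \<Rightarrow> 'a set \<Rightarrow> ereal" where
  "canonical_fun S p j = contract p (canonical_chain S p (j - 1))"

definition canonical_length :: "'a set \<Rightarrow> ('a set \<Rightarrow> ereal) \<Rightarrow> nat" where
  "canonical_length S p = (LEAST j. canonical_chain S p j = S)"

definition canonical_base :: "'a set \<Rightarrow> ('a set \<Rightarrow> ereal) \<Rightarrow> nat \<Rightarrow> ('a \<Rightarrow> real) set" where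
  "canonical_base S p i = base_polyhedron (canonical_set S p i) (canonical_fun S p i)"

definition canonical_box :: "'a set \<Rightarrow> ('a set \<Rightarrow> ereal) \<Rightarrow> nat \<Rightarrow> ('a \<Rightarrow> real) set" where
  "canonical_box S p i =
     {x \<in> canonical_set S p i \<rightarrow>\<^sub>E UNIV. \<forall>s\<in>canonical_set S p i.
        canonical_value S p i - 1 \<le> ereal (x s) \<and> ereal (x s) \<le> canonical_value S p i}"


text \<open>The iteration terminates, so \<^const>\<open>canonical_length\<close> is a genuine minimum.\<close>

lemma ereal_shift_sum_le:
  fixes a b c d :: ereal
  assumes "a + b \<le> c + d" "c \<noteq> \<infinity>" "d \<noteq> \<infinity>" "r + s = t + u"
  shows "(a - ereal r) + (b - ereal s) \<le> (c - ereal t) + (d - ereal u)"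
  using assms by (cases a; cases b; cases c; cases d) simp_all

lemma step_set_props:
  assumes fin: "finite S" and int: "int_or_MInf_on S p" and sup: "supermodular_on S p"
    and pS: "\<bar>p S\<bar> \<noteq> \<infinity>" and C: "C \<subseteq> S" "C \<noteq> S" and pC: "\<bar>p C\<bar> \<noteq> \<infinity>"
  shows "step_set S p C \<noteq> {}" "step_set S p C \<subseteq> S - C" "\<bar>p (C \<union> step_set S p C)\<bar> \<noteq> \<infinity>"
proof -
  define D where "D = S - C"
  define f where "f = contract p C"
  define b where "b = step_value S p C"
  define h where "h = step_fun S p C"
  obtain c where c: "p C = ereal c" using pC by auto
  have D: "D \<noteq> {}" "finite D" "D \<subseteq> S" "D \<union> C = S" using C fin by (auto simp: D_def)
  have pub: "p X \<noteq> \<infinity>" if "X \<subseteq> S" for X using int that by (auto simp: int_or_MInf_on_def)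
  have f: "f X = p (X \<union> C) - ereal c" for X by (simp add: f_def contract_def c)
  have fub: "f X \<noteq> \<infinity>" if "X \<subseteq> D" for X
    using pub[of "X \<union> C"] that D C by (cases "p (X \<union> C)") (auto simp: f)
  have f0: "f {} = 0" by (simp add: f c)
  obtain d where fD: "f D = ereal d" using pS D by (cases "p S") (auto simp: f)
  have fsup: "f X + f Y \<le> f (X \<inter> Y) + f (X \<union> Y)" if XY: "X \<subseteq> D" "Y \<subseteq> D" for X Y
  proof -
    have *: "p (X \<union> C) + p (Y \<union> C) \<le> p ((X \<union> C) \<inter> (Y \<union> C)) + p ((X \<union> C) \<union> (Y \<union> C))"
      using sup[unfolded supermodular_on_def, rule_format, of "X \<union> C" "Y \<union> C"] XY D(3) C(1) by blast
    have e: "(X \<union> C) \<inter> (Y \<union> C) = (X \<inter> Y) \<union> C" "(X \<union> C) \<union> (Y \<union> C) = (X \<union> Y) \<union> C" by auto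
    have n: "p (X \<union> C) \<noteq> \<infinity>" "p (Y \<union> C) \<noteq> \<infinity>" "p (X \<inter> Y \<union> C) \<noteq> \<infinity>" "p (X \<union> Y \<union> C) \<noteq> \<infinity>"
      using XY D C by (auto intro!: pub)
    show ?thesis unfolding f by (rule ereal_shift_sum_le[OF *[unfolded e] n(3,4)]) simp
  qed
  let ?A = "{ereal_ceiling (f X / ereal (real (card X))) | X. X \<noteq> {} \<and> X \<subseteq> D}"
  have "?A = (\<lambda>X. ereal_ceiling (f X / ereal (real (card X)))) ` (Pow D - {{}})" by auto
  then have finA: "finite ?A" using D by simp
  have cardpos: "real (card X) > 0" if "X \<noteq> {}" "X \<subseteq> D" for X
    using that D(2) by (meson card_gt_0_iff finite_subset of_nat_0_less_iff)
  have bA: "b = Max ?A" by (simp add: b_def step_value_def f_def D_def)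
  have Dm: "ereal_ceiling (f D / ereal (real (card D))) \<in> ?A" using D by auto
  then have neA: "?A \<noteq> {}" by blast
  have "ereal_ceiling (f D / ereal (real (card D))) \<le> b"
    unfolding bA using finA Dm by (rule Max_ge)
  moreover have "ereal_ceiling (f D / ereal (real (card D))) \<noteq> -\<infinity>"
    using cardpos[of D] D by (simp add: fD ereal_ceiling_def)
  ultimately have bn: "b \<noteq> -\<infinity>" by auto
  have "b \<in> ?A" unfolding bA using finA neA by (rule Max_in)
  then obtain X where X: "X \<noteq> {}" "X \<subseteq> D" and bX: "b = ereal_ceiling (f X / ereal (real (card X)))"
    by blast
  have cX: "real (card X) > 0" using cardpos X by blast
  obtain u where u: "f X = ereal u"
    using bX bn fub[OF X(2)] cX by (cases "f X") (auto simp: ereal_ceiling_def)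
  define k where "k = \<lceil>u / real (card X)\<rceil>"
  have bk: "b = ereal (of_int k)" using bX cX by (simp add: u ereal_ceiling_def k_def)
  have h: "h Y = f Y - ereal ((of_int k - 1) * real (card Y))" for Y
    using bk by (simp add: h_def step_fun_def f_def[symmetric] b_def[symmetric] one_ereal_def)
  have "of_int k - 1 < u / real (card X)" unfolding k_def by linarith
  then have "(of_int k - 1) * real (card X) < u" using cX by (simp add: pos_less_divide_eq)
  then have hX: "h X > 0" by (simp add: h u)
  have h0: "h {} = 0" by (simp add: h f0)
  have hub: "h Y \<noteq> \<infinity>" if "Y \<subseteq> D" for Y using fub[OF that] by (cases "f Y") (auto simp: h)
  have hsup: "h X + h Y \<le> h (X \<inter> Y) + h (X \<union> Y)" if XY: "X \<subseteq> D" "Y \<subseteq> D" for X Y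
  proof -
    have "card X + card Y = card (X \<inter> Y) + card (X \<union> Y)"
      using card_Un_Int[of X Y] XY D(2) by (simp add: finite_subset)
    then have "real (card X) + real (card Y) = real (card (X \<inter> Y)) + real (card (X \<union> Y))"
      by (metis of_nat_add)
    then have *: "(of_int k - 1) * real (card X) + (of_int k - 1) * real (card Y) =
      (of_int k - 1) * real (card (X \<inter> Y)) + (of_int k - 1) * real (card (X \<union> Y))"
      by (metis distrib_left)
    have n: "f X \<noteq> \<infinity>" "f Y \<noteq> \<infinity>" "f (X \<inter> Y) \<noteq> \<infinity>" "f (X \<union> Y) \<noteq> \<infinity>"
      using XY by (auto intro!: fub)
    show ?thesis unfolding h by (rule ereal_shift_sum_le[OF fsup[OF XY] n(3,4) *])
  qed
  let ?M = "{X. X \<subseteq> D \<and> (\<forall>Y\<subseteq>D. h Y \<le> h X)}"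
  have sM: "step_set S p C = \<Inter>?M" by (simp add: step_set_def h_def D_def)
  have finM: "finite ?M" using D(2) by simp
  have "Max (h ` Pow D) \<in> h ` Pow D" by (rule Max_in) (use D(2) in auto)
  then obtain Z where Z: "Z \<subseteq> D" "h Z = Max (h ` Pow D)" by (metis PowD imageE)
  then have "Z \<in> ?M" using D(2) by auto
  then have neM: "?M \<noteq> {}" by blast
  have Mint: "V \<inter> W \<in> ?M" if V: "V \<in> ?M" and W: "W \<in> ?M" for V W
  proof -
    have sub: "V \<subseteq> D" "W \<subseteq> D" "V \<inter> W \<subseteq> D" "V \<union> W \<subseteq> D" using V W by auto
    have VW: "h V = h W" using V W by (simp add: order_antisym)
    have "h V > 0" using V hX X by (auto intro: less_le_trans)
    then obtain v where v: "h V = ereal v" using hub[OF sub(1)] by (cases "h V") auto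
    have "h V + h W \<le> h (V \<inter> W) + h (V \<union> W)" using hsup sub by blast
    moreover have "h (V \<union> W) \<le> h V" using V sub by blast
    ultimately have "h V \<le> h (V \<inter> W)"
      using v VW hub[OF sub(3)] hub[OF sub(4)] by (cases "h (V \<inter> W)"; cases "h (V \<union> W)") auto
    then show ?thesis using V sub by (auto intro: order_trans)
  qed
  have I: "\<Inter>?M \<in> ?M" using finite_Inf_in[OF finM neM] Mint by blast
  have hI: "h (\<Inter>?M) > 0" using I hX X by (auto intro: less_le_trans)
  show "step_set S p C \<noteq> {}" unfolding sM using hI h0 by auto
  show sub: "step_set S p C \<subseteq> S - C" unfolding sM using I by (simp add: D_def)
  have "p (step_set S p C \<union> C) \<noteq> \<infinity>" by (rule pub) (use sub C in auto)
  moreover have "p (step_set S p C \<union> C) \<noteq> -\<infinity>" using hI[folded sM] by (auto simp: h f)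
  ultimately show "\<bar>p (C \<union> step_set S p C)\<bar> \<noteq> \<infinity>"
    by (cases "p (step_set S p C \<union> C)") (auto simp: Un_commute)
qed

lemma canonical_chain_length:
  assumes "finite S" "int_or_MInf_on S p" "supermodular_on S p" "p {} = 0" "\<bar>p S\<bar> \<noteq> \<infinity>"
  shows "canonical_chain S p (canonical_length S p) = S"
proof -
  let ?C = "canonical_chain S p"
  have *: "?C j = S \<or> (?C j \<subseteq> S \<and> \<bar>p (?C j)\<bar> \<noteq> \<infinity> \<and> j \<le> card (?C j))" for j
  proof (induction j)
    case 0
    then show ?case using assms by simp
  next
    case (Suc j)
    show ?case
    proof (cases "?C j = S")
      case True
      have "step_set S p S \<subseteq> {}" unfolding step_set_def by (rule Inter_lower) simp
      then show ?thesis using True by simp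
    next
      case False
      with Suc have s: "?C j \<subseteq> S" "\<bar>p (?C j)\<bar> \<noteq> \<infinity>" "j \<le> card (?C j)" by auto
      note t = step_set_props[OF assms(1-3,5) s(1) False s(2)]
      have "?C j \<subset> ?C (Suc j)" "?C (Suc j) \<subseteq> S" using t s by auto
      moreover from this have "card (?C j) < card (?C (Suc j))"
        using assms(1) by (meson finite_subset psubset_card_mono)
      ultimately show ?thesis using t s by auto
    qed
  qed
  have "?C (Suc (card S)) = S"
    using *[of "Suc (card S)"] card_mono[OF assms(1), of "?C (Suc (card S))"] by linarith
  then show ?thesis unfolding canonical_length_def by (rule LeastI)
qed

end

theory Submission
  imports Defs
begin

text \<open>
  For an integer \<open>a\<close> let the excess of \<open>x\<close> over \<open>a\<close> be \<open>\<Sum>\<^sub>s max 0 (x s - a)\<close>. If \<open>\<beta>\<^sub>i > a \<ge> \<beta>\<^sub>i\<^sub>+\<^sub>1\<close>,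
  every \<open>y\<close> in \<open>B\<close> has excess at least \<open>y(C\<^sub>i) - a |C\<^sub>i| \<ge> p(C\<^sub>i) - a |C\<^sub>i|\<close>. Both inequalities are
  equalities for the members of the direct sum \<open>P\<close> of the \<open>B\<^sub>i \<inter> T\<^sub>i\<close>, so these minimise all excesses
  simultaneously (they are least majorized), which makes the integral ones decreasingly minimal.
  Conversely, two vectors with the same sorted list have the same excesses, and equality in the two
  bounds for \<open>a = \<beta>\<^sub>i\<close> and \<open>a = \<beta>\<^sub>i - 1\<close> forces a member of \<open>B\<close> into \<open>P\<close>; it remains to see that \<open>P\<close> has
  an integral point. The inequalities \<open>p\<^sub>i(X) \<le> \<beta>\<^sub>i |X|\<close> (choice of \<open>\<beta>\<^sub>i\<close>) and \<open>h\<^sub>i(X) \<le> h\<^sub>i(S\<^sub>i)\<close>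
  (choice of \<open>S\<^sub>i\<close>) are exactly what makes each \<open>B\<^sub>i \<inter> T\<^sub>i\<close> the base polyhedron of a finite integral
  supermodular function, and for those the greedy algorithm yields an integral point.
\<close>

section \<open>Excess over a threshold and the decreasing order\<close>

definition excess :: "'a set \<Rightarrow> ('a \<Rightarrow> real) \<Rightarrow> real \<Rightarrow> real" where
  "excess S x a = (\<Sum>s\<in>S. max 0 (x s - a))"

text \<open>Since only the sorted list enters the right-hand side, vectors with equal sorted lists
  have equal excess over every \<open>a\<close>. The converse direction of the characterization gets
  its equalities from this.\<close>

lemma excess_eq_sum_list:
  "excess S x a = sum_list (map (\<lambda>t. max 0 (t - a)) (decreasing_list S x))"
proof -
  have m: "mset (decreasing_list S x) = image_mset x (mset_set S)"
    by (simp add: decreasing_list_def)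
  have "sum_list (map (\<lambda>t. max 0 (t - a)) (decreasing_list S x))
      = sum_mset (image_mset (\<lambda>t. max 0 (t - a)) (mset (decreasing_list S x)))"
    by (metis mset_map sum_mset_sum_list)
  also have "\<dots> = sum_mset (image_mset (\<lambda>s. max 0 (x s - a)) (mset_set S))"
    unfolding m by (simp add: image_mset.compositionality comp_def)
  also have "\<dots> = excess S x a"
    by (simp add: excess_def sum_unfold_sum_mset)
  finally show ?thesis ..
qed

lemma sorted_decreasing_list: "sorted_wrt (\<ge>) (decreasing_list S x)"
  by (simp add: decreasing_list_def sorted_wrt_rev)

lemma set_decreasing_list: "finite S \<Longrightarrow> set (decreasing_list S x) = x ` S"
  by (simp add: decreasing_list_def)

lemma length_decreasing_list: "length (decreasing_list S x) = card S"
proof -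
  have "mset (decreasing_list S x) = image_mset x (mset_set S)"
    by (simp add: decreasing_list_def)
  then show ?thesis by (metis size_image_mset size_mset size_mset_set)
qed

text \<open>Suppose the list of \<open>x\<close> were larger. The lists have equal length, so at the
  first difference \<open>y\<close> has some \<open>a\<close> and \<open>x\<close> some
  \<open>b > a\<close>. Over the threshold \<open>a\<close> the common prefix contributes equally,
  the rest of \<open>y\<close> contributes nothing, and \<open>x\<close> gains at least
  \<open>b - a\<close>, so its excess is larger. Only values of \<open>y\<close> occur as
  thresholds, hence only integers when \<open>y\<close> is integral.\<close>

lemma lexordp_eq_if_excess_le:
  assumes fin: "finite S" and le: "\<And>a. a \<in> y ` S \<Longrightarrow> excess S x a \<le> excess S y a"
  shows "ord_class.lexordp_eq (decreasing_list S x) (decreasing_list S y)"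
proof (rule ccontr)
  let ?x = "decreasing_list S x" and ?y = "decreasing_list S y"
  assume "\<not> ord_class.lexordp_eq ?x ?y"
  then have "ord_class.lexordp ?y ?x"
    using lexordp_linear[of ?x ?y] lexordp_into_lexordp_eq lexordp_eq_refl by metis
  then have "(?y, ?x) \<in> lexord {(u, v). u < v}" by (simp add: lexordp_conv_lexord)
  then consider c v where "?x = ?y @ c # v"
    | u a b v w where "a < b" "?y = u @ a # v" "?x = u @ b # w"
    unfolding lexord_def by auto
  then show False
  proof cases
    case 1
    then have "length ?x > length ?y" by simp
    then show False by (simp add: length_decreasing_list)
  next
    case 2
    let ?f = "\<lambda>t. max 0 (t - a)"
    have "a \<in> set ?y" using 2 by simp
    then have "excess S x a \<le> excess S y a" using fin by (intro le) (simp add: set_decreasing_list)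
    moreover have "sum_list (map ?f v) = 0"
    proof -
      have "\<forall>t\<in>set v. t \<le> a"
        using sorted_decreasing_list[of S y] 2 by (auto simp: sorted_wrt_append)
      then have "map ?f v = map (\<lambda>_. 0) v" by (intro map_cong) auto
      then show ?thesis by (simp only: sum_list_0)
    qed
    moreover have "sum_list (map ?f w) \<ge> 0" by (intro sum_list_nonneg) auto
    ultimately show False using 2(1) by (simp add: excess_eq_sum_list 2(2,3))
  qed
qed

text \<open>The excess minus the left-hand side is a sum of nonnegative terms \<open>d s\<close>:
  \<open>max 0 (a - x s)\<close> on \<open>T\<close> and \<open>max 0 (x s - a)\<close> outside
  \<open>T\<close>. Equality means that each of them vanishes.\<close>

lemma
  assumes fin: "finite S" and T: "T \<subseteq> S"
  shows sum_le_excess: "(\<Sum>s\<in>T. x s) - a * real (card T) \<le> excess S x a"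
    and sum_eq_excess_iff: "(\<Sum>s\<in>T. x s) - a * real (card T) = excess S x a \<longleftrightarrow>
      (\<forall>s\<in>T. a \<le> x s) \<and> (\<forall>s\<in>S - T. x s \<le> a)"
proof -
  define d where "d s = max 0 (x s - a) - (if s \<in> T then x s - a else 0)" for s
  have "(\<Sum>s\<in>T. x s - a) = (\<Sum>s\<in>S. if s \<in> T then x s - a else 0)"
    using fin T by (simp add: sum.If_cases Int_absorb1)
  then have eq: "excess S x a - ((\<Sum>s\<in>T. x s) - a * real (card T)) = (\<Sum>s\<in>S. d s)"
    by (simp add: d_def excess_def sum_subtractf mult.commute)
  have d: "d s \<ge> 0" for s by (simp add: d_def)
  then have "(\<Sum>s\<in>S. d s) \<ge> 0" by (simp add: sum_nonneg)
  with eq show "(\<Sum>s\<in>T. x s) - a * real (card T) \<le> excess S x a" by linarith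
  have "(\<Sum>s\<in>T. x s) - a * real (card T) = excess S x a \<longleftrightarrow> (\<Sum>s\<in>S. d s) = 0"
    using eq by linarith
  also have "\<dots> \<longleftrightarrow> (\<forall>s\<in>S. d s = 0)" using fin d by (simp add: sum_nonneg_eq_0_iff)
  also have "\<dots> \<longleftrightarrow> (\<forall>s\<in>T. a \<le> x s) \<and> (\<forall>s\<in>S - T. x s \<le> a)"
  proof -
    have "d s = 0 \<longleftrightarrow> (if s \<in> T then a \<le> x s else x s \<le> a)" for s by (auto simp: d_def)
    then show ?thesis using T by auto
  qed
  finally show "(\<Sum>s\<in>T. x s) - a * real (card T) = excess S x a \<longleftrightarrow>
      (\<forall>s\<in>T. a \<le> x s) \<and> (\<forall>s\<in>S - T. x s \<le> a)" .
qed

section \<open>Base polyhedra: integral points, boxes and direct sums\<close>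

lemma restrict_in_base_polyhedron:
  "restrict x A \<in> base_polyhedron A f \<longleftrightarrow>
    ereal (sum x A) = f A \<and> (\<forall>Z\<subseteq>A. f Z \<le> ereal (sum x Z))"
proof -
  have "sum (restrict x A) Z = sum x Z" if "Z \<subseteq> A" for Z
    using that by (intro sum.cong) auto
  then show ?thesis by (simp add: base_polyhedron_def)
qed

text \<open>Greedily, each new element \<open>s\<close> gets its marginal value \<open>r (insert s A) - r A\<close>.\<close>

lemma supermodular_int_base_nonempty:
  fixes r :: "'a set \<Rightarrow> int"
  assumes "finite S" "r {} = 0"
    and "\<And>X Y. X \<subseteq> S \<Longrightarrow> Y \<subseteq> S \<Longrightarrow> r X + r Y \<le> r (X \<inter> Y) + r (X \<union> Y)"
  shows "\<exists>x. sum x S = r S \<and> (\<forall>Z\<subseteq>S. r Z \<le> sum x Z)"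
  using assms(1,3)
proof (induction S rule: finite_induct)
  case empty
  then show ?case using assms(2) by simp
next
  case (insert s A)
  have "\<exists>x. sum x A = r A \<and> (\<forall>Z\<subseteq>A. r Z \<le> sum x Z)"
    by (rule insert.IH) (use insert.prems in blast)
  then obtain x where x: "sum x A = r A" "\<And>Z. Z \<subseteq> A \<Longrightarrow> r Z \<le> sum x Z" by blast
  define y where "y = x(s := r (insert s A) - r A)"
  have y: "sum y Z = sum x Z" if "Z \<subseteq> A" for Z
    using that insert.hyps by (intro sum.cong) (auto simp: y_def)
  have "r Z \<le> sum y Z" if Z: "Z \<subseteq> insert s A" for Z
  proof (cases "s \<in> Z")
    case False
    then have "Z \<subseteq> A" using Z by blast
    then show ?thesis using x y by simp
  next
    case True
    have fZ: "finite Z" using Z insert.hyps finite_subset by blast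
    have s: "Z \<inter> A = Z - {s}" "Z \<union> A = insert s A" "Z - {s} \<subseteq> A"
      using True Z insert.hyps by auto
    \<comment> \<open>Supermodularity for \<open>Z\<close> and the earlier elements \<open>A\<close>
      bounds \<open>r Z - r (Z - {s})\<close> by the marginal value given to
      \<open>s\<close>.\<close>
    have "r Z + r A \<le> r (Z \<inter> A) + r (Z \<union> A)" using insert.prems Z by blast
    then have "r Z \<le> r (Z - {s}) + (r (insert s A) - r A)" by (simp add: s)
    also have "\<dots> \<le> sum y (Z - {s}) + y s" using x(2)[OF s(3)] y[OF s(3)] by (simp add: y_def)
    also have "\<dots> = sum y Z" using True fZ by (simp add: sum.remove)
    finally show ?thesis .
  qed
  moreover have "sum y (insert s A) = r (insert s A)"
    using insert.hyps y[of A] x(1) by (simp add: y_def)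
  ultimately show ?case by blast
qed

text \<open>The new set function is \<open>r(Z) = max\<^sub>X p(X) + l(Z - X) - u(X - Z)\<close>;
  taking \<open>X = {}\<close> shows that it is finite everywhere.\<close>

lemma base_polyhedron_Int_box:
  fixes p :: "'a set \<Rightarrow> ereal" and l u :: "'a \<Rightarrow> int"
  assumes fin: "finite S" and int: "int_or_MInf_on S p" and sup: "supermodular_on S p"
    and p0: "p {} = 0" and pS: "p S = ereal (real_of_int k)"
    and lu: "\<And>s. s \<in> S \<Longrightarrow> l s \<le> u s"
    and pu: "\<And>X. X \<subseteq> S \<Longrightarrow> p X \<le> ereal (real_of_int (sum u X))"
    and pl: "\<And>X. X \<subseteq> S \<Longrightarrow> p X \<le> ereal (real_of_int (k - sum l (S - X)))"
  obtains r :: "'a set \<Rightarrow> int" where "r {} = 0"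
    and "\<And>X Y. X \<subseteq> S \<Longrightarrow> Y \<subseteq> S \<Longrightarrow> r X + r Y \<le> r (X \<inter> Y) + r (X \<union> Y)"
    and "base_polyhedron S (\<lambda>X. ereal (real_of_int (r X))) =
      base_polyhedron S p \<inter> {x. \<forall>s\<in>S. real_of_int (l s) \<le> x s \<and> x s \<le> real_of_int (u s)}"
proof -
  define w :: "'a set \<Rightarrow> 'a set \<Rightarrow> int" where "w Z X = (\<Sum>s\<in>S. if s \<in> Z \<and> s \<notin> X then l s
    else if s \<in> X \<and> s \<notin> Z then - u s else 0)" for Z X
  define V where "V Z X = p X + ereal (real_of_int (w Z X))" for Z X
  have p: "p X = -\<infinity> \<or> (\<exists>i::int. p X = ereal (of_int i))" if "X \<subseteq> S" for X
    using int that by (auto simp: int_or_MInf_on_def)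
  \<comment> \<open>Compared element by element, the two sides agree except where an element lies in
    \<open>Z - X\<close> and in \<open>X' - Z'\<close>, or the other way round: there the left side
    is \<open>l s - u s\<close> and the right side is 0.\<close>
  have w_super: "w Z X + w Z' X' \<le> w (Z \<inter> Z') (X \<inter> X') + w (Z \<union> Z') (X \<union> X')" for Z X Z' X'
    unfolding w_def sum.distrib[symmetric] by (intro sum_mono) (use lu in auto)
  have w0: "w {} X = - sum u X" if "X \<subseteq> S" for X
    using fin that unfolding w_def sum_negf[symmetric]
    by (intro sum.mono_neutral_cong_right) auto
  have wS: "w S X = sum l (S - X)" if "X \<subseteq> S" for X
    using fin that unfolding w_def by (intro sum.mono_neutral_cong_right) auto
  have wZ: "w Z {} = sum l Z" if "Z \<subseteq> S" for Z
    using fin that unfolding w_def by (intro sum.mono_neutral_cong_right) auto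
  have ww: "w Z Z = 0" for Z unfolding w_def by (intro sum.neutral) auto
  have "\<exists>i X. X \<subseteq> S \<and> V Z X = ereal (real_of_int i) \<and> (\<forall>Y\<subseteq>S. V Z Y \<le> V Z X)" for Z
  proof -
    have "Max (V Z ` Pow S) \<in> V Z ` Pow S" by (rule Max_in) (use fin in auto)
    then obtain X where X: "X \<subseteq> S" "V Z X = Max (V Z ` Pow S)" by (metis PowD imageE)
    then have max: "\<forall>Y\<subseteq>S. V Z Y \<le> V Z X" using fin by auto
    then have "V Z {} \<le> V Z X" by simp
    then have "p X \<noteq> -\<infinity>" by (auto simp: V_def p0)
    then obtain i :: int where "p X = ereal (of_int i)" using p X(1) by blast
    then have "V Z X = ereal (real_of_int (i + w Z X))" by (simp add: V_def)
    with X max show ?thesis by blast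
  qed
  then obtain r M where M: "\<And>Z. M Z \<subseteq> S" and rM: "\<And>Z. V Z (M Z) = ereal (real_of_int (r Z))"
    and "\<And>Z Y. Y \<subseteq> S \<Longrightarrow> V Z Y \<le> V Z (M Z)" by metis
  then have r_ge: "V Z Y \<le> ereal (real_of_int (r Z))" if "Y \<subseteq> S" for Z Y using that by metis
  have pM: "p (M Z) = ereal (real_of_int (r Z - w Z (M Z)))" for Z
    using rM[of Z] by (cases "p (M Z)") (auto simp: V_def)
  \<comment> \<open>By \<open>pu\<close> no \<open>X\<close> beats \<open>X = {}\<close> in the
    maximum for \<open>Z = {}\<close>, and by \<open>pl\<close> none beats \<open>X = S\<close> in
    the maximum for \<open>Z = S\<close>. So \<open>r\<close> keeps the values of \<open>p\<close>
    at both ends.\<close>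
  have r0: "r {} = 0"
  proof (rule antisym)
    show "r {} \<le> 0" using pu[OF M[of "{}"]] unfolding pM by (simp add: w0 M)
    show "0 \<le> r {}" using r_ge[of "{}" "{}"] by (simp add: V_def ww p0)
  qed
  have rS: "r S = k"
  proof (rule antisym)
    show "r S \<le> k" using pl[OF M[of S]] unfolding pM by (simp add: wS M)
    show "k \<le> r S" using r_ge[of S S] by (simp add: V_def ww pS)
  qed
  have r_super: "r X + r Y \<le> r (X \<inter> Y) + r (X \<union> Y)" for X Y
  proof -
    \<comment> \<open>Uncrossing: the intersection and the union of the maximizers for
      \<open>X\<close> and \<open>Y\<close> are candidates in the maxima that define
      \<open>r (X \<inter> Y)\<close> and \<open>r (X \<union> Y)\<close>.\<close>
    let ?I = "M X \<inter> M Y" and ?U = "M X \<union> M Y"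
    have sub: "?I \<subseteq> S" "?U \<subseteq> S" using M by blast+
    have *: "p (M X) + p (M Y) \<le> p ?I + p ?U"
      using sup M by (auto simp: supermodular_on_def)
    obtain i j :: int where ij: "p ?I = ereal (of_int i)" "p ?U = ereal (of_int j)"
      using * p[OF sub(1)] p[OF sub(2)] by (auto simp: pM)
    have "r X - w X (M X) + (r Y - w Y (M Y)) \<le> i + j"
      using * by (simp only: pM ij plus_ereal.simps ereal_less_eq of_int_add[symmetric] of_int_le_iff)
    moreover have "i + w (X \<inter> Y) ?I \<le> r (X \<inter> Y)" "j + w (X \<union> Y) ?U \<le> r (X \<union> Y)"
      using r_ge[OF sub(1), of "X \<inter> Y"] r_ge[OF sub(2), of "X \<union> Y"]
      by (simp_all only: V_def ij plus_ereal.simps ereal_less_eq of_int_add[symmetric] of_int_le_iff)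
    ultimately show ?thesis using w_super[of X "M X" Y "M Y"] by linarith
  qed
  have "base_polyhedron S (\<lambda>X. ereal (real_of_int (r X))) =
      base_polyhedron S p \<inter> {x. \<forall>s\<in>S. real_of_int (l s) \<le> x s \<and> x s \<le> real_of_int (u s)}"
  proof (intro set_eqI iffI)
    fix x assume "x \<in> base_polyhedron S (\<lambda>X. ereal (real_of_int (r X)))"
    then have x: "x \<in> S \<rightarrow>\<^sub>E UNIV" "(\<Sum>s\<in>S. x s) = k" "\<And>Z. Z \<subseteq> S \<Longrightarrow> r Z \<le> (\<Sum>s\<in>Z. x s)"
      by (auto simp: base_polyhedron_def rS)
    have "p Z \<le> ereal (\<Sum>s\<in>Z. x s)" if Z: "Z \<subseteq> S" for Z
    proof -
      have "p Z \<le> ereal (r Z)" using r_ge[OF Z, of Z] by (simp add: V_def ww)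
      also have "\<dots> \<le> ereal (\<Sum>s\<in>Z. x s)" using x(3)[OF Z] by simp
      finally show ?thesis .
    qed
    moreover have "l s \<le> x s \<and> x s \<le> u s" if s: "s \<in> S" for s
    proof
      \<comment> \<open>The candidate \<open>{}\<close> in the maximum for \<open>{s}\<close> gives
        the lower bound. The candidate \<open>S\<close> in the maximum for \<open>S - {s}\<close>
        gives the upper bound, after passing to the complement.\<close>
      have "real_of_int (l s) \<le> r {s}"
        using r_ge[of "{}" "{s}"] s by (simp add: V_def wZ p0)
      then show "l s \<le> x s" using x(3)[of "{s}"] s by simp
      have "w (S - {s}) S = - u s"
      proof -
        have "w (S - {s}) S = (\<Sum>t\<in>{s}. - u t)"
          using fin s unfolding w_def by (intro sum.mono_neutral_cong_right) auto
        then show ?thesis by simp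
      qed
      then have "real_of_int k - u s \<le> r (S - {s})"
        using r_ge[of S "S - {s}"] by (simp add: V_def pS)
      then have "real_of_int k - u s \<le> (\<Sum>t\<in>S - {s}. x t)" using x(3)[of "S - {s}"] by auto
      then show "x s \<le> u s" using x(2) s fin by (simp add: sum.remove)
    qed
    ultimately show "x \<in> base_polyhedron S p \<inter>
        {x. \<forall>s\<in>S. real_of_int (l s) \<le> x s \<and> x s \<le> real_of_int (u s)}"
      using x(1,2) by (auto simp: base_polyhedron_def pS)
  next
    fix x assume "x \<in> base_polyhedron S p \<inter>
      {x. \<forall>s\<in>S. real_of_int (l s) \<le> x s \<and> x s \<le> real_of_int (u s)}"
    then have x: "x \<in> S \<rightarrow>\<^sub>E UNIV" "(\<Sum>s\<in>S. x s) = k" "\<And>Z. Z \<subseteq> S \<Longrightarrow> p Z \<le> ereal (\<Sum>s\<in>Z. x s)"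
      and b: "\<And>s. s \<in> S \<Longrightarrow> l s \<le> x s \<and> x s \<le> u s"
      by (auto simp: base_polyhedron_def pS)
    have "real_of_int (r Z) \<le> (\<Sum>s\<in>Z. x s)" if Z: "Z \<subseteq> S" for Z
    proof -
      have ind: "(\<Sum>s\<in>Y. x s) = (\<Sum>s\<in>S. if s \<in> Y then x s else 0)" if "Y \<subseteq> S" for Y
        using fin that by (simp add: sum.If_cases Int_absorb1)
      \<comment> \<open>Passing from \<open>M Z\<close> to \<open>Z\<close> adds elements of value
        at least \<open>l\<close> and drops elements of value at most \<open>u\<close>.\<close>
      have "(\<Sum>s\<in>M Z. x s) + w Z (M Z) \<le> (\<Sum>s\<in>Z. x s)"
        unfolding ind[OF M] ind[OF Z] w_def of_int_sum sum.distrib[symmetric]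
        by (intro sum_mono) (use b in auto)
      moreover have "real_of_int (r Z - w Z (M Z)) \<le> (\<Sum>s\<in>M Z. x s)"
        using x(3)[OF M[of Z]] unfolding pM by simp
      ultimately show ?thesis by simp
    qed
    then show "x \<in> base_polyhedron S (\<lambda>X. ereal (real_of_int (r X)))"
      using x(1,2) by (auto simp: base_polyhedron_def rS)
  qed
  with r0 r_super show ?thesis by (intro that)
qed

text \<open>From left to right the constraints of the disjoint blocks are added up. Conversely, for
  \<open>Z\<close> inside one block the other blocks contribute \<open>r j {} = 0\<close>, which
  gives the inequalities of that block; the slacks \<open>sum x (A i) - r i (A i)\<close> are then
  nonnegative with total 0, so every block is tight.\<close>

lemma direct_sum_base_polyhedron:
  fixes r :: "'i \<Rightarrow> 'a set \<Rightarrow> int"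
  assumes I: "finite I" and fin: "\<And>i. i \<in> I \<Longrightarrow> finite (A i)"
    and disj: "\<And>i j. i \<in> I \<Longrightarrow> j \<in> I \<Longrightarrow> i \<noteq> j \<Longrightarrow> A i \<inter> A j = {}"
    and r0: "\<And>i. i \<in> I \<Longrightarrow> r i {} = 0"
  shows "direct_sum I A (\<lambda>i. base_polyhedron (A i) (\<lambda>X. ereal (real_of_int (r i X)))) =
    base_polyhedron (\<Union>i\<in>I. A i) (\<lambda>X. ereal (real_of_int (\<Sum>i\<in>I. r i (X \<inter> A i))))"
    (is "?L = ?R")
proof (intro set_eqI iffI)
  let ?S = "\<Union>i\<in>I. A i"
  have split: "sum x Z = (\<Sum>i\<in>I. sum x (Z \<inter> A i))" if "Z \<subseteq> ?S" for x :: "'a \<Rightarrow> real" and Z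
  proof -
    have "Z = (\<Union>i\<in>I. Z \<inter> A i)" using that by blast
    then have "sum x Z = sum x (\<Union>i\<in>I. Z \<inter> A i)" by simp
    also have "\<dots> = (\<Sum>i\<in>I. sum x (Z \<inter> A i))"
      by (rule sum.UNION_disjoint) (use I fin disj in blast)+
    finally show ?thesis .
  qed
  have SA: "?S \<inter> A i = A i" if "i \<in> I" for i using that by blast
  {
    fix x assume "x \<in> ?L"
    then have x: "x \<in> ?S \<rightarrow>\<^sub>E UNIV" and eq: "\<And>i. i \<in> I \<Longrightarrow> sum x (A i) = r i (A i)"
      and ge: "\<And>i Z. i \<in> I \<Longrightarrow> Z \<subseteq> A i \<Longrightarrow> r i Z \<le> sum x Z"
      by (auto simp: direct_sum_def restrict_in_base_polyhedron)
    have "sum x ?S = (\<Sum>i\<in>I. r i (?S \<inter> A i))"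
      by (simp add: split SA eq)
    moreover have "(\<Sum>i\<in>I. r i (Z \<inter> A i)) \<le> sum x Z" if "Z \<subseteq> ?S" for Z
      unfolding split[OF that] of_int_sum by (intro sum_mono ge) auto
    ultimately show "x \<in> ?R" using x by (simp add: base_polyhedron_def)
  next
    fix x assume "x \<in> ?R"
    then have x: "x \<in> ?S \<rightarrow>\<^sub>E UNIV" and eq: "sum x ?S = (\<Sum>i\<in>I. r i (?S \<inter> A i))"
      and ge: "\<And>Z. Z \<subseteq> ?S \<Longrightarrow> real_of_int (\<Sum>i\<in>I. r i (Z \<inter> A i)) \<le> sum x Z"
      by (simp_all add: base_polyhedron_def)
    have one: "r i Z \<le> sum x Z" if i: "i \<in> I" and Z: "Z \<subseteq> A i" for i Z
    proof -
      have "(\<Sum>j\<in>I. r j (Z \<inter> A j)) = (\<Sum>j\<in>{i}. r j (Z \<inter> A j))"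
      proof (rule sum.mono_neutral_right[OF I])
        show "\<forall>j\<in>I - {i}. r j (Z \<inter> A j) = 0"
        proof
          fix j assume "j \<in> I - {i}"
          then have "Z \<inter> A j = {}" using disj[of i j] i Z by blast
          then show "r j (Z \<inter> A j) = 0" using r0 \<open>j \<in> I - {i}\<close> by simp
        qed
      qed (use i in auto)
      also have "\<dots> = r i Z" using Z by (simp add: Int_absorb2)
      finally show ?thesis using ge[of Z] i Z by auto
    qed
    have "(\<Sum>i\<in>I. sum x (A i) - r i (A i)) = 0"
      using eq by (simp add: split SA sum_subtractf)
    then have "\<forall>i\<in>I. sum x (A i) - r i (A i) = 0"
      using one by (subst (asm) sum_nonneg_eq_0_iff[OF I]) auto
    then show "x \<in> ?L"
      using x one by (auto simp: direct_sum_def restrict_in_base_polyhedron)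
  }
qed

section \<open>Contractions and a single step of the iteration\<close>

lemma
  assumes int: "int_or_MInf_on S p" and sup: "supermodular_on S p"
    and C: "C \<subseteq> S" and pC: "\<bar>p C\<bar> \<noteq> \<infinity>" and D: "D \<subseteq> S - C"
  shows int_or_MInf_on_contract: "int_or_MInf_on D (contract p C)"
    and supermodular_on_contract: "supermodular_on D (contract p C)"
proof -
  have p: "p X = -\<infinity> \<or> (\<exists>i::int. p X = ereal (of_int i))" if "X \<subseteq> S" for X
    using int that by (auto simp: int_or_MInf_on_def)
  obtain c :: int where c: "p C = ereal (of_int c)" using p[OF C] pC by auto
  show "int_or_MInf_on D (contract p C)"
    unfolding int_or_MInf_on_def
  proof (intro allI impI)
    fix X assume "X \<subseteq> D"
    then have "X \<union> C \<subseteq> S" using C D by blast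
    from p[OF this] consider "p (X \<union> C) = -\<infinity>" | i :: int where "p (X \<union> C) = ereal (of_int i)"
      by blast
    then show "contract p C X = -\<infinity> \<or> (\<exists>k::int. contract p C X = ereal (of_int k))"
    proof cases
      case 2
      then have "contract p C X = ereal (of_int (i - c))" by (simp add: contract_def c)
      then show ?thesis by blast
    qed (simp add: contract_def c)
  qed
  show "supermodular_on D (contract p C)"
    unfolding supermodular_on_def
  proof (intro allI impI)
    fix X Y assume XY: "X \<subseteq> D" "Y \<subseteq> D"
    have e: "(X \<union> C) \<inter> (Y \<union> C) = X \<inter> Y \<union> C" "(X \<union> C) \<union> (Y \<union> C) = X \<union> Y \<union> C" by auto
    have s: "X \<union> C \<subseteq> S" "Y \<union> C \<subseteq> S" "X \<inter> Y \<union> C \<subseteq> S" "X \<union> Y \<union> C \<subseteq> S"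
      using XY C D by auto
    have "p (X \<union> C) + p (Y \<union> C) \<le> p (X \<inter> Y \<union> C) + p (X \<union> Y \<union> C)"
      using sup[unfolded supermodular_on_def, rule_format, OF s(1,2)] by (simp only: e)
    moreover have "p (X \<inter> Y \<union> C) \<noteq> \<infinity>" "p (X \<union> Y \<union> C) \<noteq> \<infinity>" using p[OF s(3)] p[OF s(4)] by auto
    ultimately show "contract p C X + contract p C Y \<le> contract p C (X \<inter> Y) + contract p C (X \<union> Y)"
      unfolding contract_def c by (intro ereal_shift_sum_le) auto
  qed
qed

text \<open>Records the two choices made in a step as inequalities with an integer \<open>k\<close>.
  The first is the maximality of the ceiling. For the second, maximizers of a supermodular function
  are closed under intersection, so \<open>step_set\<close>, the intersection of them all, is itself
  a maximizer.\<close>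

lemma step_value_and_maximizer:
  assumes fin: "finite S" and int: "int_or_MInf_on S p" and sup: "supermodular_on S p"
    and pS: "\<bar>p S\<bar> \<noteq> \<infinity>" and C: "C \<subseteq> S" "C \<noteq> S" and pC: "\<bar>p C\<bar> \<noteq> \<infinity>"
  obtains k :: int where "step_value S p C = ereal (of_int k)"
    and "\<And>X. X \<subseteq> S - C \<Longrightarrow> contract p C X \<le> ereal (of_int k * real (card X))"
    and "\<And>X. X \<subseteq> S - C \<Longrightarrow> contract p C X - ereal ((of_int k - 1) * real (card X)) \<le>
      contract p C (step_set S p C) - ereal ((of_int k - 1) * real (card (step_set S p C)))"
proof -
  define D where "D = S - C"
  define f where "f = contract p C"
  define h where "h = step_fun S p C"
  have D: "finite D" "D \<noteq> {}" "D \<union> C = S" using C fin by (auto simp: D_def)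
  have fint: "f X = -\<infinity> \<or> (\<exists>i::int. f X = ereal (of_int i))" if "X \<subseteq> D" for X
    using int_or_MInf_on_contract[OF int sup C(1) pC, of D] that
    by (auto simp: int_or_MInf_on_def D_def f_def)
  have fsup: "f X + f Y \<le> f (X \<inter> Y) + f (X \<union> Y)" if "X \<subseteq> D" "Y \<subseteq> D" for X Y
    using supermodular_on_contract[OF int sup C(1) pC, of D] that
    by (auto simp: supermodular_on_def D_def f_def)
  have f0: "f {} = 0" using pC by (cases "p C") (auto simp: f_def contract_def)
  have "f D \<noteq> -\<infinity>" using pS pC D by (cases "p S"; cases "p C") (auto simp: f_def contract_def)
  then obtain d :: int where fD: "f D = ereal (of_int d)" using fint[of D] by auto
  define c where "c X = ereal_ceiling (f X / ereal (real (card X)))" for X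
  have cardpos: "real (card X) > 0" if "X \<noteq> {}" "X \<subseteq> D" for X
    using that D(1) by (meson card_gt_0_iff finite_subset of_nat_0_less_iff)
  have b: "step_value S p C = Max (c ` (Pow D - {{}}))"
    unfolding step_value_def c_def f_def D_def by (rule arg_cong[where f = Max]) auto
  have le: "c X \<le> step_value S p C" if "X \<noteq> {}" "X \<subseteq> D" for X
    unfolding b by (rule Max_ge) (use D that in auto)
  have "step_value S p C \<in> c ` (Pow D - {{}})" unfolding b by (rule Max_in) (use D in auto)
  then obtain X where X: "X \<noteq> {}" "X \<subseteq> D" "step_value S p C = c X" by auto
  \<comment> \<open>The value of \<open>f\<close> at \<open>D\<close> is finite, so the maximum lies
    above \<open>-\<infinity>\<close>. It is therefore attained where \<open>f\<close> is a finite
    integer, and so it is an integer itself.\<close>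
  have "c D \<noteq> -\<infinity>" using cardpos[of D] D by (simp add: c_def fD ereal_ceiling_def)
  then have "c X \<noteq> -\<infinity>" using le[of D] D X by auto
  then have "f X \<noteq> -\<infinity>" using cardpos[OF X(1,2)] by (auto simp: c_def ereal_ceiling_def)
  then obtain i :: int where "f X = ereal (of_int i)" using fint[OF X(2)] by auto
  then have "c X = ereal (of_int \<lceil>of_int i / real (card X)\<rceil>)"
    using cardpos[OF X(1,2)] by (simp add: c_def ereal_ceiling_def)
  then obtain k :: int where k: "step_value S p C = ereal (of_int k)" using X by metis
  have fk: "f X \<le> ereal (of_int k * real (card X))" if XD: "X \<subseteq> D" for X
  proof (cases "X = {} \<or> f X = -\<infinity>")
    case True
    then show ?thesis by (auto simp: f0)
  next
    case False
    then obtain i :: int where i: "f X = ereal (of_int i)" using fint[OF XD] by auto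
    have "c X = ereal (of_int \<lceil>of_int i / real (card X)\<rceil>)"
      using cardpos[of X] False XD by (simp add: c_def i ereal_ceiling_def)
    then have "\<lceil>of_int i / real (card X)\<rceil> \<le> k" using le[of X] False XD k by simp
    then have "of_int i / real (card X) \<le> of_int k" by (simp add: ceiling_le_iff)
    then show ?thesis using cardpos[of X] False XD by (simp add: i pos_divide_le_eq)
  qed
  have h: "h Y = f Y - ereal ((of_int k - 1) * real (card Y))" for Y
    by (simp add: h_def step_fun_def f_def k one_ereal_def)
  have hub: "h Y \<noteq> \<infinity>" if "Y \<subseteq> D" for Y using fint[OF that] by (auto simp: h)
  have hsup: "h X + h Y \<le> h (X \<inter> Y) + h (X \<union> Y)" if XY: "X \<subseteq> D" "Y \<subseteq> D" for X Y
  proof -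
    have "real (card X) + real (card Y) = real (card (X \<inter> Y)) + real (card (X \<union> Y))"
      using card_Un_Int[of X Y] XY D(1) by (metis add.commute finite_subset of_nat_add)
    then have *: "(of_int k - 1) * real (card X) + (of_int k - 1) * real (card Y) =
      (of_int k - 1) * real (card (X \<inter> Y)) + (of_int k - 1) * real (card (X \<union> Y))"
      by (metis distrib_left)
    have "X \<inter> Y \<subseteq> D" "X \<union> Y \<subseteq> D" using XY by auto
    then have "f (X \<inter> Y) \<noteq> \<infinity>" "f (X \<union> Y) \<noteq> \<infinity>"
      using fint[of "X \<inter> Y"] fint[of "X \<union> Y"] by auto
    then show ?thesis unfolding h by (rule ereal_shift_sum_le[OF fsup[OF XY] _ _ *])
  qed
  let ?M = "{X. X \<subseteq> D \<and> (\<forall>Y\<subseteq>D. h Y \<le> h X)}"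
  have "Max (h ` Pow D) \<in> h ` Pow D" by (rule Max_in) (use D(1) in auto)
  then obtain Z where "Z \<subseteq> D" "h Z = Max (h ` Pow D)" by (metis PowD imageE)
  then have "Z \<in> ?M" using D(1) by auto
  then have neM: "?M \<noteq> {}" by blast
  have Mint: "V \<inter> W \<in> ?M" if V: "V \<in> ?M" and W: "W \<in> ?M" for V W
  proof -
    have sub: "V \<subseteq> D" "W \<subseteq> D" "V \<inter> W \<subseteq> D" "V \<union> W \<subseteq> D" using V W by auto
    have VW: "h V = h W" using V W by (simp add: order_antisym)
    have "h {} \<le> h V" using V by blast
    then obtain v where v: "h V = ereal v" using hub[OF sub(1)] by (cases "h V") (auto simp: h f0)
    have "h V + h W \<le> h (V \<inter> W) + h (V \<union> W)" using hsup sub by blast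
    moreover have "h (V \<union> W) \<le> h V" using V sub by blast
    \<comment> \<open>\<open>h V = h W\<close> is the finite maximum and \<open>V \<union> W\<close>
      cannot exceed it, so \<open>V \<inter> W\<close> must reach it.\<close>
    ultimately have "h V \<le> h (V \<inter> W)"
      using v VW hub[OF sub(3)] hub[OF sub(4)] by (cases "h (V \<inter> W)"; cases "h (V \<union> W)") auto
    then show ?thesis using V sub by (auto intro: order_trans)
  qed
  have "\<Inter>?M \<in> ?M" using finite_Inf_in[OF _ neM] Mint D(1) by simp
  moreover have "step_set S p C = \<Inter>?M" by (simp add: step_set_def h_def D_def)
  ultimately have "step_set S p C \<in> ?M" by metis
  then have "h X \<le> h (step_set S p C)" if "X \<subseteq> D" for X using that by blast
  with k fk show ?thesis unfolding h by (intro that[of k]) (auto simp: D_def f_def)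
qed

section \<open>The canonical chain and its strictly decreasing values\<close>

locale supermodular_base =
  fixes S :: "'a set" and p :: "'a set \<Rightarrow> ereal"
  assumes fin: "finite S" and int: "int_or_MInf_on S p" and sup: "supermodular_on S p"
    and p0: "p {} = 0" and pS: "\<bar>p S\<bar> \<noteq> \<infinity>"
begin

abbreviation "C \<equiv> canonical_chain S p"
abbreviation "A \<equiv> canonical_set S p"
abbreviation "q \<equiv> canonical_length S p"
abbreviation "decmin_polyhedron \<equiv>
  direct_sum {1..q} A (\<lambda>i. canonical_base S p i \<inter> canonical_box S p i)"

text \<open>The essential value as an integer. For indices from 1 to \<open>q\<close> it is integral
  already, so the floor only changes the type.\<close>

definition val :: "nat \<Rightarrow> int" where
  "val i = \<lfloor>real_of_ereal (canonical_value S p i)\<rfloor>"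

text \<open>Finiteness of \<open>p (C j)\<close> keeps the subtraction in every contraction
  meaningful. The induction also covers the indices past \<open>q\<close>, where the step set is
  empty.\<close>

lemma chain_finite: "C j \<subseteq> S \<and> \<bar>p (C j)\<bar> \<noteq> \<infinity>"
proof (induction j)
  case 0
  then show ?case by (simp add: p0)
next
  case (Suc j)
  show ?case
  proof (cases "C j = S")
    case True
    have "step_set S p S \<subseteq> {}" unfolding step_set_def by (rule Inter_lower) simp
    then show ?thesis using True pS by simp
  next
    case False
    then show ?thesis using step_set_props[OF fin int sup pS _ False] Suc by auto
  qed
qed

lemma p_int_or_MInf: "X \<subseteq> S \<Longrightarrow> p X = -\<infinity> \<or> (\<exists>i::int. p X = ereal (of_int i))"
  using int by (auto simp: int_or_MInf_on_def)

lemma p_chain: obtains c :: int where "p (C j) = ereal (of_int c)"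
  using p_int_or_MInf[of "C j"] chain_finite[of j] by auto

lemma chain_length: "C q = S"
  using canonical_chain_length[OF fin int sup p0 pS] .

lemma chain_neq: "j < q \<Longrightarrow> C j \<noteq> S"
  unfolding canonical_length_def by (rule not_less_Least)

lemma chain_Suc: "C (Suc j) = C j \<union> A (Suc j)"
  by (simp add: canonical_set_def)

declare canonical_chain.simps(2) [simp del]

lemma chain_eq_UN: "C j = (\<Union>i\<in>{1..j}. A i)"
proof (induction j)
  case (Suc j)
  then show ?case unfolding chain_Suc by (simp add: atLeastAtMostSuc_conv Un_commute)
qed simp

lemma set_subset: "j < q \<Longrightarrow> A (Suc j) \<subseteq> S - C j"
  using step_set_props(2)[OF fin int sup pS _ chain_neq[of j]] chain_finite[of j]
  by (simp add: canonical_set_def)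

lemma sets_disjoint:
  assumes "i \<in> {1..q}" "j \<in> {1..q}" "i \<noteq> j"
  shows "A i \<inter> A j = {}"
proof -
  have *: "A i \<inter> A (Suc j) = {}" if "1 \<le> i" "i \<le> j" "j < q" for i j
    using set_subset[OF that(3)] that(1,2) by (auto simp: chain_eq_UN)
  show ?thesis
    using *[of i "j - 1"] *[of j "i - 1"] assms
    by (cases i j rule: linorder_cases) (auto simp: Int_commute)
qed

lemma UN_sets: "(\<Union>i\<in>{1..q}. A i) = S"
  using chain_eq_UN[of q] chain_length by simp

lemma
  assumes j: "j < q"
  shows canonical_value_eq: "canonical_value S p (Suc j) = ereal (of_int (val (Suc j)))"
    and contract_le_val: "X \<subseteq> S - C j \<Longrightarrow>
      contract p (C j) X \<le> ereal (of_int (val (Suc j)) * real (card X))"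
    and set_maximizes: "X \<subseteq> S - C j \<Longrightarrow>
      contract p (C j) X - ereal ((of_int (val (Suc j)) - 1) * real (card X)) \<le>
      contract p (C j) (A (Suc j)) - ereal ((of_int (val (Suc j)) - 1) * real (card (A (Suc j))))"
proof -
  obtain k :: int where k: "step_value S p (C j) = ereal (of_int k)"
    and 1: "\<And>X. X \<subseteq> S - C j \<Longrightarrow> contract p (C j) X \<le> ereal (of_int k * real (card X))"
    and 2: "\<And>X. X \<subseteq> S - C j \<Longrightarrow> contract p (C j) X - ereal ((of_int k - 1) * real (card X)) \<le>
      contract p (C j) (A (Suc j)) - ereal ((of_int k - 1) * real (card (A (Suc j))))"
    using step_value_and_maximizer[OF fin int sup pS _ chain_neq[OF j]] chain_finite[of j]
    by (auto simp: canonical_set_def)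
  have v: "val (Suc j) = k" by (simp add: val_def canonical_value_def k)
  show "canonical_value S p (Suc j) = ereal (of_int (val (Suc j)))"
    by (simp add: v canonical_value_def k)
  show "X \<subseteq> S - C j \<Longrightarrow> contract p (C j) X \<le> ereal (of_int (val (Suc j)) * real (card X))"
    "X \<subseteq> S - C j \<Longrightarrow>
      contract p (C j) X - ereal ((of_int (val (Suc j)) - 1) * real (card X)) \<le>
      contract p (C j) (A (Suc j)) - ereal ((of_int (val (Suc j)) - 1) * real (card (A (Suc j))))"
    using 1 2 by (simp_all add: v)
qed

lemma contract_empty: "contract p (C j) {} = 0"
  by (rule p_chain[of j]) (simp add: contract_def)

lemma contract_set: "contract p (C j) (A (Suc j)) = p (C (Suc j)) - p (C j)"
  by (simp only: contract_def chain_Suc Un_commute)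

text \<open>For \<open>X\<close> disjoint from \<open>C (Suc j)\<close>, the set
  \<open>X \<union> A (Suc j)\<close> cannot beat the maximizer \<open>A (Suc j)\<close>.
  Subtracting the two values leaves \<open>contract p (C (Suc j)) X\<close> at most
  \<open>val (Suc j) - 1\<close> times \<open>card X\<close>, so every ceiling in the next maximum
  is at most \<open>val (Suc j) - 1\<close>.\<close>

lemma val_Suc_less:
  assumes "Suc j < q"
  shows "val (Suc (Suc j)) < val (Suc j)"
proof -
  let ?v = "val (Suc j)" and ?C = "C (Suc j)"
  have j: "j < q" using assms by simp
  obtain c where c: "p (C j) = ereal (real_of_int c)" by (rule p_chain)
  obtain c' where c': "p ?C = ereal (real_of_int c')" by (rule p_chain)
  have le: "contract p ?C X \<le> ereal ((of_int ?v - 1) * real (card X))" if X: "X \<subseteq> S - ?C" for X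
  proof -
    let ?Y = "X \<union> A (Suc j)"
    have "?Y \<subseteq> S - C j" using X set_subset[OF j] chain_Suc[of j] by auto
    note max = set_maximizes[OF j this]
    have "finite X" "finite (A (Suc j))" "X \<inter> A (Suc j) = {}"
      using X set_subset[OF j] fin chain_Suc[of j] by (auto intro: finite_subset)
    then have card: "card ?Y = card X + card (A (Suc j))" by (simp add: card_Un_disjoint)
    have "?Y \<union> C j = X \<union> ?C" unfolding chain_Suc by auto
    then have "contract p (C j) ?Y = p (X \<union> ?C) - ereal (of_int c)" by (simp add: contract_def c)
    with max show ?thesis
      unfolding contract_set card c c' contract_def[of p ?C]
      by (cases "p (X \<union> ?C)") (auto simp: algebra_simps)
  qed
  have "step_value S p ?C \<le> ereal (of_int (?v - 1))"
  proof -
    let ?V = "{ereal_ceiling (contract p ?C X / ereal (real (card X))) | X. X \<noteq> {} \<and> X \<subseteq> S - ?C}"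
    have "?V = (\<lambda>X. ereal_ceiling (contract p ?C X / ereal (real (card X)))) ` (Pow (S - ?C) - {{}})"
      by auto
    then have "finite ?V" using fin by simp
    moreover have "?V \<noteq> {}" using chain_neq[OF assms] chain_finite[of "Suc j"] by blast
    moreover have "t \<le> ereal (of_int (?v - 1))" if t: "t \<in> ?V" for t
    proof -
      obtain X where X: "X \<noteq> {}" "X \<subseteq> S - ?C"
        and tX: "t = ereal_ceiling (contract p ?C X / ereal (real (card X)))" using t by blast
      have pos: "real (card X) > 0"
        using X fin by (metis card_gt_0_iff finite_Diff finite_subset of_nat_0_less_iff)
      show ?thesis
      proof (cases "contract p ?C X")
        case (real r)
        then have "r / real (card X) \<le> of_int (?v - 1)"
          using le[OF X(2)] pos by (simp add: pos_divide_le_eq)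
        then have "\<lceil>r / real (card X)\<rceil> \<le> ?v - 1" by (rule ceiling_le)
        then have "real_of_int \<lceil>r / real (card X)\<rceil> \<le> of_int (?v - 1)" using of_int_le_iff by blast
        then show ?thesis using pos by (simp add: tX real ereal_ceiling_def)
      qed (use le[OF X(2)] pos in \<open>auto simp: tX ereal_ceiling_def\<close>)
    qed
    ultimately show ?thesis unfolding step_value_def by (intro Max.boundedI)
  qed
  moreover have "step_value S p ?C = ereal (of_int (val (Suc (Suc j))))"
    using canonical_value_eq[OF assms] by (simp add: canonical_value_def)
  ultimately have "val (Suc (Suc j)) \<le> ?v - 1" by (simp only: ereal_less_eq of_int_le_iff)
  then show ?thesis by simp
qed

lemma val_antimono: "1 \<le> i \<Longrightarrow> i \<le> j \<Longrightarrow> j \<le> q \<Longrightarrow> val j \<le> val i"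
proof (induction j rule: nat_induct)
  case (Suc j)
  show ?case
  proof (cases "i = Suc j")
    case False
    then obtain j' where "j = Suc j'" using Suc.prems by (cases j) auto
    then show ?thesis using Suc False val_Suc_less[of j'] by auto
  qed simp
qed simp

section \<open>The direct sum of the bounded bases\<close>

lemma restrict_mem_iff:
  assumes "j < q"
  shows "restrict x (A (Suc j)) \<in> canonical_base S p (Suc j) \<inter> canonical_box S p (Suc j) \<longleftrightarrow>
    ereal (sum x (A (Suc j))) = p (C (Suc j)) - p (C j) \<and>
    (\<forall>Z\<subseteq>A (Suc j). contract p (C j) Z \<le> ereal (sum x Z)) \<and>
    (\<forall>s\<in>A (Suc j). of_int (val (Suc j)) - 1 \<le> x s \<and> x s \<le> of_int (val (Suc j)))"
proof -
  have "restrict x (A (Suc j)) \<in> canonical_box S p (Suc j) \<longleftrightarrow>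
    (\<forall>s\<in>A (Suc j). of_int (val (Suc j)) - 1 \<le> x s \<and> x s \<le> of_int (val (Suc j)))"
    by (simp add: canonical_box_def canonical_value_eq[OF assms] one_ereal_def)
  moreover have "restrict x (A (Suc j)) \<in> canonical_base S p (Suc j) \<longleftrightarrow>
    ereal (sum x (A (Suc j))) = p (C (Suc j)) - p (C j) \<and>
    (\<forall>Z\<subseteq>A (Suc j). contract p (C j) Z \<le> ereal (sum x Z))"
    by (simp add: canonical_base_def canonical_fun_def restrict_in_base_polyhedron
        contract_set[symmetric])
  ultimately show ?thesis by blast
qed

lemma all_index_iff: "(\<forall>i\<in>{1..q}. P i) \<longleftrightarrow> (\<forall>j<q. P (Suc j))"
  unfolding image_Suc_lessThan[symmetric] by (simp add: Ball_def image_iff) blast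

lemma mem_decmin_polyhedron_iff: "x \<in> decmin_polyhedron \<longleftrightarrow> x \<in> S \<rightarrow>\<^sub>E UNIV \<and>
    (\<forall>j<q. restrict x (A (Suc j)) \<in> canonical_base S p (Suc j) \<inter> canonical_box S p (Suc j))"
  unfolding direct_sum_def UN_sets all_index_iff by (simp only: mem_Collect_eq)

lemma sum_chain_Suc:
  assumes "j < q"
  shows "sum x (C (Suc j)) = sum x (C j) + (sum x (A (Suc j)) :: real)"
  unfolding chain_Suc
  using set_subset[OF assms] chain_finite[of j] finite_subset[OF _ fin]
  by (intro sum.union_disjoint) auto

text \<open>The block sums \<open>p (C (Suc j)) - p (C j)\<close> telescope.\<close>

lemma decmin_polyhedron_chain:
  assumes x: "x \<in> decmin_polyhedron"
  shows "j \<le> q \<Longrightarrow> ereal (sum x (C j)) = p (C j)"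
proof (induction j)
  case 0
  then show ?case by (simp add: p0)
next
  case (Suc j)
  then have j: "j < q" by simp
  have "ereal (sum x (A (Suc j))) = p (C (Suc j)) - p (C j)"
    using x j unfolding mem_decmin_polyhedron_iff by (meson restrict_mem_iff)
  then show ?case
    using Suc chain_finite[of "Suc j"] unfolding sum_chain_Suc[OF j]
    by (cases "p (C (Suc j))"; cases "p (C j)") auto
qed

text \<open>A given \<open>Z\<close> is built up along the chain. Supermodularity for
  \<open>Z \<inter> C (Suc j)\<close> and \<open>C j\<close> bounds the growth of \<open>p\<close>
  from \<open>Z \<inter> C j\<close> to \<open>Z \<inter> C (Suc j)\<close> by the contracted value
  of \<open>Z \<inter> A (Suc j)\<close>, which the block constraint bounds by the sum of
  \<open>x\<close> there.\<close>

lemma decmin_polyhedron_subset: "decmin_polyhedron \<subseteq> base_polyhedron S p"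
proof
  fix x assume x: "x \<in> decmin_polyhedron"
  have "p (Z \<inter> C j) \<le> ereal (sum x (Z \<inter> C j))" if Z: "Z \<subseteq> S" and "j \<le> q" for Z j
    using \<open>j \<le> q\<close>
  proof (induction j)
    case 0
    then show ?case by (simp add: p0)
  next
    case (Suc j)
    then have j: "j < q" by simp
    let ?X = "Z \<inter> C (Suc j)" and ?W = "Z \<inter> A (Suc j)"
    have e: "?X \<inter> C j = Z \<inter> C j" "?X \<union> C j = ?W \<union> C j" unfolding chain_Suc by auto
    have "p ?X + p (C j) \<le> p (?X \<inter> C j) + p (?X \<union> C j)"
      using sup Z chain_finite[of j] unfolding supermodular_on_def by (meson inf.coboundedI1)
    then have 1: "p ?X + p (C j) \<le> p (Z \<inter> C j) + p (?W \<union> C j)" unfolding e .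
    have 2: "contract p (C j) ?W \<le> ereal (sum x ?W)"
      using x j unfolding mem_decmin_polyhedron_iff by (meson inf_le2 restrict_mem_iff)
    have "sum x ?X = sum x (Z \<inter> C j) + sum x ?W"
      unfolding chain_Suc Int_Un_distrib
      using set_subset[OF j] finite_subset[OF Z fin] by (intro sum.union_disjoint) auto
    with 1 2 Suc.IH j chain_finite[of j] show ?case
      unfolding contract_def
      by (cases "p ?X"; cases "p (C j)"; cases "p (Z \<inter> C j)"; cases "p (?W \<union> C j)") auto
  qed
  from this[of _ q] have "p Z \<le> ereal (sum x Z)" if "Z \<subseteq> S" for Z
    using that by (simp add: chain_length Int_absorb2)
  moreover have "ereal (sum x S) = p S" using decmin_polyhedron_chain[OF x, of q] chain_length by simp
  ultimately show "x \<in> base_polyhedron S p"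
    using x unfolding base_polyhedron_def mem_decmin_polyhedron_iff by simp
qed

text \<open>An instance of \<open>base_polyhedron_Int_box\<close> with constant bounds: the choice
  of the value supplies the upper condition, the choice of the set the lower one.\<close>

lemma canonical_base_Int_box:
  assumes j: "j < q"
  obtains r :: "'a set \<Rightarrow> int" where "r {} = 0"
    and "\<And>X Y. X \<subseteq> A (Suc j) \<Longrightarrow> Y \<subseteq> A (Suc j) \<Longrightarrow> r X + r Y \<le> r (X \<inter> Y) + r (X \<union> Y)"
    and "canonical_base S p (Suc j) \<inter> canonical_box S p (Suc j) =
      base_polyhedron (A (Suc j)) (\<lambda>X. ereal (real_of_int (r X)))"
proof -
  let ?A = "A (Suc j)" and ?v = "val (Suc j)" and ?f = "contract p (C j)"
  obtain c where c: "p (C j) = ereal (real_of_int c)" by (rule p_chain)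
  obtain c' where c': "p (C (Suc j)) = ereal (real_of_int c')" by (rule p_chain)
  have A: "?A \<subseteq> S - C j" "finite ?A" using set_subset[OF j] fin by (auto intro: finite_subset)
  have contr: "int_or_MInf_on ?A ?f" "supermodular_on ?A ?f"
    using int_or_MInf_on_contract[OF int sup _ _ A(1)] supermodular_on_contract[OF int sup _ _ A(1)]
      chain_finite[of j] by simp_all
  have fA: "?f ?A = ereal (of_int (c' - c))" by (simp add: contract_set c c')
  have up: "?f X \<le> ereal (real_of_int (\<Sum>s\<in>X. ?v))" if "X \<subseteq> ?A" for X
    using contract_le_val[OF j, of X] that A by (auto simp: mult.commute)
  \<comment> \<open>This is the maximality of \<open>A (Suc j)\<close>, rewritten by splitting its
    cardinality into those of \<open>X\<close> and its complement.\<close>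
  have low: "?f X \<le> ereal (real_of_int (c' - c - (\<Sum>s\<in>?A - X. ?v - 1)))" if X: "X \<subseteq> ?A" for X
  proof -
    have "card (?A - X) + card X = card ?A"
      using X A(2) by (metis card_Diff_subset card_mono finite_subset le_add_diff_inverse2)
    then have card: "real (card ?A) = real (card (?A - X)) + real (card X)" by linarith
    have "X \<subseteq> S - C j" using X A by blast
    from set_maximizes[OF j this, unfolded fA card] show ?thesis
      by (cases "?f X") (auto simp: algebra_simps)
  qed
  obtain r :: "'a set \<Rightarrow> int" where "r {} = 0"
    and "\<And>X Y. X \<subseteq> ?A \<Longrightarrow> Y \<subseteq> ?A \<Longrightarrow> r X + r Y \<le> r (X \<inter> Y) + r (X \<union> Y)"
    and eq: "base_polyhedron ?A (\<lambda>X. ereal (real_of_int (r X))) =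
      base_polyhedron ?A ?f \<inter> {x. \<forall>s\<in>?A. real_of_int (?v - 1) \<le> x s \<and> x s \<le> real_of_int ?v}"
    by (rule base_polyhedron_Int_box[where l = "\<lambda>_. ?v - 1" and u = "\<lambda>_. ?v",
        OF A(2) contr contract_empty fA _ up low]) auto
  moreover have "canonical_base S p (Suc j) \<inter> canonical_box S p (Suc j) =
      base_polyhedron ?A ?f \<inter> {x. \<forall>s\<in>?A. real_of_int (?v - 1) \<le> x s \<and> x s \<le> real_of_int ?v}"
    by (auto simp: canonical_base_def canonical_fun_def canonical_box_def base_polyhedron_def
        canonical_value_eq[OF j] one_ereal_def)
  ultimately show ?thesis by (intro that[of r]) simp_all
qed

text \<open>\<open>R\<close> adds up the block functions, each evaluated on the trace of
  \<open>X\<close> in its block, and inherits supermodularity summand by summand. Its integrality is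
  what the greedy construction needs.\<close>

lemma decmin_polyhedron_eq:
  obtains R :: "'a set \<Rightarrow> int" where "R {} = 0"
    and "\<And>X Y. X \<subseteq> S \<Longrightarrow> Y \<subseteq> S \<Longrightarrow> R X + R Y \<le> R (X \<inter> Y) + R (X \<union> Y)"
    and "decmin_polyhedron = base_polyhedron S (\<lambda>X. ereal (real_of_int (R X)))"
proof -
  have "\<exists>r :: 'a set \<Rightarrow> int. r {} = 0 \<and>
      (\<forall>X Y. X \<subseteq> A i \<longrightarrow> Y \<subseteq> A i \<longrightarrow> r X + r Y \<le> r (X \<inter> Y) + r (X \<union> Y)) \<and>
      canonical_base S p i \<inter> canonical_box S p i =
        base_polyhedron (A i) (\<lambda>X. ereal (real_of_int (r X)))" if i: "i \<in> {1..q}" for i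
  proof -
    obtain j where "i = Suc j" "j < q" using i by (cases i) auto
    then show ?thesis using canonical_base_Int_box[of j] by metis
  qed
  then obtain r :: "nat \<Rightarrow> 'a set \<Rightarrow> int" where r0: "\<And>i. i \<in> {1..q} \<Longrightarrow> r i {} = 0"
    and rsup: "\<And>i X Y. i \<in> {1..q} \<Longrightarrow> X \<subseteq> A i \<Longrightarrow> Y \<subseteq> A i \<Longrightarrow>
      r i X + r i Y \<le> r i (X \<inter> Y) + r i (X \<union> Y)"
    and req: "\<And>i. i \<in> {1..q} \<Longrightarrow> canonical_base S p i \<inter> canonical_box S p i =
        base_polyhedron (A i) (\<lambda>X. ereal (real_of_int (r i X)))"
    by metis
  define R where "R X = (\<Sum>i\<in>{1..q}. r i (X \<inter> A i))" for X
  have finA: "finite (A i)" if "i \<in> {1..q}" for i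
    using UN_sets fin that by (metis UN_upper finite_subset)
  have "decmin_polyhedron =
      direct_sum {1..q} A (\<lambda>i. base_polyhedron (A i) (\<lambda>X. ereal (real_of_int (r i X))))"
    by (simp add: direct_sum_def req)
  also have "\<dots> = base_polyhedron S (\<lambda>X. ereal (real_of_int (R X)))"
    using direct_sum_base_polyhedron[of "{1..q}" A r, OF _ finA sets_disjoint r0]
    unfolding R_def UN_sets by simp
  finally have "decmin_polyhedron = base_polyhedron S (\<lambda>X. ereal (real_of_int (R X)))" .
  moreover have "R {} = 0" by (simp add: R_def r0)
  moreover have "R X + R Y \<le> R (X \<inter> Y) + R (X \<union> Y)" for X Y
    unfolding R_def sum.distrib[symmetric]
  proof (rule sum_mono)
    fix i assume "i \<in> {1..q}"
    from rsup[OF this, of "X \<inter> A i" "Y \<inter> A i"]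
    show "r i (X \<inter> A i) + r i (Y \<inter> A i) \<le> r i (X \<inter> Y \<inter> A i) + r i ((X \<union> Y) \<inter> A i)"
      by (simp add: Int_Un_distrib2 Int_ac)
  qed
  ultimately show ?thesis by (intro that)
qed

lemma is_base_polyhedron_decmin_polyhedron: "is_base_polyhedron S decmin_polyhedron"
proof -
  obtain R :: "'a set \<Rightarrow> int" where R: "R {} = 0"
    "\<And>X Y. X \<subseteq> S \<Longrightarrow> Y \<subseteq> S \<Longrightarrow> R X + R Y \<le> R (X \<inter> Y) + R (X \<union> Y)"
    "decmin_polyhedron = base_polyhedron S (\<lambda>X. ereal (real_of_int (R X)))"
    using decmin_polyhedron_eq by blast
  have "supermodular_on S (\<lambda>X. ereal (real_of_int (R X)))"
    unfolding supermodular_on_def plus_ereal.simps ereal_less_eq of_int_add[symmetric] of_int_le_iff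
    using R(2) by blast
  then show ?thesis
    unfolding is_base_polyhedron_def using R(1,3)
    by (intro exI[of _ "\<lambda>X. ereal (real_of_int (R X))"]) (auto simp: int_or_MInf_on_def)
qed

lemma decmin_polyhedron_integral_point: "\<exists>x. x \<in> decmin_polyhedron \<inter> (S \<rightarrow>\<^sub>E \<int>)"
proof -
  obtain R :: "'a set \<Rightarrow> int" where R: "R {} = 0"
    "\<And>X Y. X \<subseteq> S \<Longrightarrow> Y \<subseteq> S \<Longrightarrow> R X + R Y \<le> R (X \<inter> Y) + R (X \<union> Y)"
    "decmin_polyhedron = base_polyhedron S (\<lambda>X. ereal (real_of_int (R X)))"
    using decmin_polyhedron_eq by blast
  obtain x where x: "sum x S = R S" "\<And>Z. Z \<subseteq> S \<Longrightarrow> R Z \<le> sum x Z"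
    using supermodular_int_base_nonempty[OF fin R(1,2)] by blast
  let ?x = "\<lambda>s. real_of_int (x s)"
  have "restrict ?x S \<in> decmin_polyhedron"
    unfolding R(3) restrict_in_base_polyhedron of_int_sum[symmetric]
    by (simp add: x del: of_int_sum)
  then show ?thesis by (intro exI[of _ "restrict ?x S"]) auto
qed

section \<open>Simultaneous minimization of all excesses\<close>

text \<open>Since the values are strictly decreasing, \<open>separates a i\<close> says that exactly \<open>\<beta>\<^sub>1, \<dots>, \<beta>\<^sub>i\<close>
  exceed \<open>a\<close>.\<close>

definition separates :: "int \<Rightarrow> nat \<Rightarrow> bool" where
  "separates a i \<longleftrightarrow> i \<le> q \<and> (i = 0 \<or> a < val i) \<and> (i = q \<or> val (Suc i) \<le> a)"

text \<open>The largest \<open>i \<le> q\<close> that is 0 or satisfies \<open>a < val i\<close>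
  works: its successor violates one of these conditions.\<close>

lemma ex_separates: "\<exists>i. separates a i"
proof -
  define P where "P i \<longleftrightarrow> i \<le> q \<and> (i = 0 \<or> a < val i)" for i
  have "P 0" by (simp add: P_def)
  moreover have "\<forall>i. P i \<longrightarrow> i \<le> q" by (simp add: P_def)
  ultimately have g: "P (Greatest P)" "P i \<Longrightarrow> i \<le> Greatest P" for i
    using GreatestI_nat[of P 0 q] Greatest_le_nat[of P i q] by blast+
  have "\<not> P (Suc (Greatest P))" using g(2)[of "Suc (Greatest P)"] by auto
  with g(1) have "separates a (Greatest P)" by (auto simp: P_def separates_def)
  then show ?thesis ..
qed

text \<open>A block inside \<open>C i\<close> has a value above \<open>a\<close>, hence, between
  integers, \<open>a \<le> val j - 1\<close>, the lower end of its box. A block outside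
  \<open>C i\<close> has a value of at most \<open>a\<close>, the upper end of its box. The first
  half depends on \<open>a\<close> being an integer.\<close>

lemma decmin_polyhedron_threshold:
  assumes x: "x \<in> decmin_polyhedron" and a: "separates a i"
  shows "(\<forall>s\<in>C i. of_int a \<le> x s) \<and> (\<forall>s\<in>S - C i. x s \<le> of_int a)"
proof -
  have box: "of_int (val j) - 1 \<le> x s \<and> x s \<le> of_int (val j)" if "j \<in> {1..q}" "s \<in> A j" for j s
  proof -
    obtain j' where "j = Suc j'" "j' < q" using \<open>j \<in> {1..q}\<close> by (cases j) auto
    then show ?thesis using x that(2) restrict_mem_iff[of j' x]
      unfolding mem_decmin_polyhedron_iff by blast
  qed
  show ?thesis
  proof (intro conjI ballI)
    fix s assume "s \<in> C i"
    then obtain j where j: "1 \<le> j" "j \<le> i" "s \<in> A j" by (auto simp: chain_eq_UN)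
    then have "a \<le> val j - 1" using a val_antimono[of j i] by (auto simp: separates_def)
    then have "real_of_int a \<le> of_int (val j) - 1" by linarith
    then show "of_int a \<le> x s" using box[of j s] j a by (auto simp: separates_def)
  next
    fix s assume s: "s \<in> S - C i"
    then obtain j where j: "j \<in> {1..q}" "s \<in> A j" using UN_sets by blast
    then have "i < j" using s by (force simp: chain_eq_UN)
    then have "val j \<le> a" using a j val_antimono[of "Suc i" j] by (auto simp: separates_def)
    then have "real_of_int (val j) \<le> of_int a" by simp
    then show "x s \<le> of_int a" using box[OF j] by linarith
  qed
qed

text \<open>The threshold property gives equality in \<open>sum_le_excess\<close>, and the chain
  sums are tight. With the cardinality term on the left, the reversed equation replaces
  \<open>p (C i)\<close> by a real number.\<close>

lemma excess_decmin_polyhedron: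
  assumes x: "x \<in> decmin_polyhedron" and a: "separates a i"
  shows "ereal (excess S x (of_int a) + of_int a * real (card (C i))) = p (C i)"
proof -
  have "sum x (C i) - of_int a * real (card (C i)) = excess S x (of_int a)"
    using decmin_polyhedron_threshold[OF x a] chain_finite[of i] sum_eq_excess_iff[OF fin] by blast
  then have "excess S x (of_int a) + of_int a * real (card (C i)) = sum x (C i)" by simp
  then show ?thesis using decmin_polyhedron_chain[OF x] a by (simp add: separates_def)
qed

text \<open>With \<open>i\<close> separating \<open>a\<close>, both excesses are at least
  \<open>p (C i)\<close> minus \<open>a\<close> times \<open>card (C i)\<close>, and
  \<open>x\<close> attains this bound.\<close>

lemma excess_le:
  assumes x: "x \<in> decmin_polyhedron" and y: "y \<in> base_polyhedron S p"
  shows "excess S x (of_int a) \<le> excess S y (of_int a)"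
proof -
  obtain i where i: "separates a i" using ex_separates by blast
  have "p (C i) \<le> ereal (sum y (C i))"
    using y chain_finite[of i] by (simp add: base_polyhedron_def)
  moreover have "sum y (C i) - of_int a * real (card (C i)) \<le> excess S y (of_int a)"
    using chain_finite[of i] by (intro sum_le_excess fin) simp
  ultimately show ?thesis unfolding excess_decmin_polyhedron[OF x i, symmetric] by simp
qed

text \<open>Equal excesses squeeze both bounds for \<open>y\<close> to equalities, so
  \<open>y\<close> is tight on the chain and satisfies the threshold conditions. These recover the
  block sums and the box bounds.\<close>

lemma excess_eq_imp_decmin_polyhedron:
  assumes x: "x \<in> decmin_polyhedron" and y: "y \<in> base_polyhedron S p"
    and eq: "\<And>a::int. excess S y (of_int a) = excess S x (of_int a)"
  shows "y \<in> decmin_polyhedron"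
proof -
  have tight: "ereal (sum y (C i)) = p (C i) \<and>
      (\<forall>s\<in>C i. of_int a \<le> y s) \<and> (\<forall>s\<in>S - C i. y s \<le> of_int a)" if i: "separates a i" for a i
  proof -
    have sub: "C i \<subseteq> S" using chain_finite by simp
    have "p (C i) \<le> ereal (sum y (C i))"
      using y sub by (simp add: base_polyhedron_def)
    then have "excess S y (of_int a) \<le> sum y (C i) - of_int a * real (card (C i))"
      unfolding excess_decmin_polyhedron[OF x i, symmetric] eq by simp
    then have *: "sum y (C i) - of_int a * real (card (C i)) = excess S y (of_int a)"
      using sum_le_excess[OF fin sub, of y "of_int a"] by simp
    then have "ereal (sum y (C i)) = p (C i)"
      unfolding excess_decmin_polyhedron[OF x i, symmetric] eq by simp
    with * show ?thesis using sum_eq_excess_iff[OF fin sub] by blast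
  qed
  \<comment> \<open>The threshold \<open>val (Suc j) - 1\<close> will give the lower end of the box
    on \<open>A (Suc j)\<close>, and the threshold \<open>val (Suc j)\<close> the upper end. The
    strict decrease of the values ensures that they separate at \<open>Suc j\<close> and at
    \<open>j\<close>.\<close>
  have low: "separates (val (Suc j) - 1) (Suc j)" if "j < q" for j
    using that val_Suc_less[of j] by (cases "Suc j = q") (auto simp: separates_def)
  have up: "separates (val (Suc j)) j" if "j < q" for j
    using that val_Suc_less[of "j - 1"] by (cases j) (auto simp: separates_def)
  have "restrict y (A (Suc j)) \<in> canonical_base S p (Suc j) \<inter> canonical_box S p (Suc j)"
    if j: "j < q" for j
    unfolding restrict_mem_iff[OF j]
  proof (intro conjI allI impI ballI)
    note 1 = tight[OF low[OF j]] and 2 = tight[OF up[OF j]]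
    show "ereal (sum y (A (Suc j))) = p (C (Suc j)) - p (C j)"
      using 1 2 sum_chain_Suc[OF j, of y] by (metis add_diff_cancel_left' ereal_minus(1))
    fix Z assume Z: "Z \<subseteq> A (Suc j)"
    then have ZS: "Z \<union> C j \<subseteq> S" "Z \<inter> C j = {}"
      using set_subset[OF j] chain_finite[of j] by auto
    \<comment> \<open>Subtracting the tight equation for \<open>C j\<close> from this constraint
      leaves the contracted one.\<close>
    have "p (Z \<union> C j) \<le> ereal (sum y (Z \<union> C j))"
      using y ZS(1) by (simp add: base_polyhedron_def)
    also have "sum y (Z \<union> C j) = sum y Z + sum y (C j)"
      using ZS finite_subset[OF ZS(1) fin] by (intro sum.union_disjoint) auto
    finally show "contract p (C j) Z \<le> ereal (sum y Z)"
      unfolding contract_def using 2 by (cases "p (Z \<union> C j)"; cases "p (C j)") auto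
  next
    fix s assume s: "s \<in> A (Suc j)"
    then have "s \<in> C (Suc j)" "s \<in> S - C j" using chain_Suc set_subset[OF j] by auto
    then show "of_int (val (Suc j)) - 1 \<le> y s" "y s \<le> of_int (val (Suc j))"
      using tight[OF low[OF j]] tight[OF up[OF j]] by auto
  qed
  moreover have "y \<in> S \<rightarrow>\<^sub>E UNIV" using y by (simp add: base_polyhedron_def)
  ultimately show ?thesis unfolding mem_decmin_polyhedron_iff by blast
qed

section \<open>Characterization of the decreasingly minimal vectors\<close>

theorem decreasingly_minimal_iff:
  "decreasingly_minimal S (base_polyhedron S p \<inter> (S \<rightarrow>\<^sub>E \<int>)) m \<longleftrightarrow>
    m \<in> decmin_polyhedron \<inter> (S \<rightarrow>\<^sub>E \<int>)"
proof
  assume m: "m \<in> decmin_polyhedron \<inter> (S \<rightarrow>\<^sub>E \<int>)"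
  have "ord_class.lexordp_eq (decreasing_list S m) (decreasing_list S y)"
    if y: "y \<in> base_polyhedron S p \<inter> (S \<rightarrow>\<^sub>E \<int>)" for y
  proof (rule lexordp_eq_if_excess_le[OF fin])
    fix a assume "a \<in> y ` S"
    then have "a \<in> \<int>" using y by auto
    then show "excess S m a \<le> excess S y a" using excess_le m y by (auto elim: Ints_cases)
  qed
  then show "decreasingly_minimal S (base_polyhedron S p \<inter> (S \<rightarrow>\<^sub>E \<int>)) m"
    using m decmin_polyhedron_subset by (auto simp: decreasingly_minimal_def)
next
  assume m: "decreasingly_minimal S (base_polyhedron S p \<inter> (S \<rightarrow>\<^sub>E \<int>)) m"
  then have mB: "m \<in> base_polyhedron S p \<inter> (S \<rightarrow>\<^sub>E \<int>)" by (simp add: decreasingly_minimal_def)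
  obtain x where x: "x \<in> decmin_polyhedron \<inter> (S \<rightarrow>\<^sub>E \<int>)"
    using decmin_polyhedron_integral_point by blast
  have "ord_class.lexordp_eq (decreasing_list S m) (decreasing_list S x)"
    using m x decmin_polyhedron_subset by (auto simp: decreasingly_minimal_def)
  \<comment> \<open>\<open>x\<close> minimises every excess, so it is also at most \<open>m\<close>
    in the order. Antisymmetry then identifies the sorted lists, though not the vectors.\<close>
  moreover have "ord_class.lexordp_eq (decreasing_list S x) (decreasing_list S m)"
  proof (rule lexordp_eq_if_excess_le[OF fin])
    fix a assume "a \<in> m ` S"
    then have "a \<in> \<int>" using mB by auto
    then show "excess S x a \<le> excess S m a" using excess_le x mB by (auto elim: Ints_cases)
  qed
  ultimately have "decreasing_list S m = decreasing_list S x" by (rule lexordp_eq_antisym)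
  then have "excess S m a = excess S x a" for a by (simp add: excess_eq_sum_list)
  then show "m \<in> decmin_polyhedron \<inter> (S \<rightarrow>\<^sub>E \<int>)"
    using excess_eq_imp_decmin_polyhedron[of x m] x mB by auto
qed

end

theorem theorem5p1:
  fixes S :: "'a set" and p :: "'a set \<Rightarrow> ereal"
  assumes "finite S" and "S \<noteq> {}"
    and "int_or_MInf_on S p" and "supermodular_on S p"
    and "p {} = 0" and "\<bar>p S\<bar> \<noteq> \<infinity>"
  shows "(\<forall>m \<in> base_polyhedron S p \<inter> (S \<rightarrow>\<^sub>E \<int>).
            decreasingly_minimal S (base_polyhedron S p \<inter> (S \<rightarrow>\<^sub>E \<int>)) m \<longleftrightarrow>
            (\<forall>i\<in>{1..canonical_length S p}.
               restrict m (canonical_set S p i) \<in> canonical_base S p i \<inter> canonical_box S p i)) \<and>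
         is_base_polyhedron S
           (direct_sum {1..canonical_length S p} (canonical_set S p)
              (\<lambda>i. canonical_base S p i \<inter> canonical_box S p i)) \<and>
         {m. decreasingly_minimal S (base_polyhedron S p \<inter> (S \<rightarrow>\<^sub>E \<int>)) m} =
           direct_sum {1..canonical_length S p} (canonical_set S p)
              (\<lambda>i. canonical_base S p i \<inter> canonical_box S p i) \<inter> (S \<rightarrow>\<^sub>E \<int>)"
proof (intro conjI ballI)
  interpret supermodular_base S p using assms by unfold_locales
  show "is_base_polyhedron S decmin_polyhedron" by (rule is_base_polyhedron_decmin_polyhedron)
  show "{m. decreasingly_minimal S (base_polyhedron S p \<inter> (S \<rightarrow>\<^sub>E \<int>)) m} =
      decmin_polyhedron \<inter> (S \<rightarrow>\<^sub>E \<int>)"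
    unfolding decreasingly_minimal_iff by (rule Collect_mem_eq)
  fix m assume m: "m \<in> base_polyhedron S p \<inter> (S \<rightarrow>\<^sub>E \<int>)"
  then have "m \<in> S \<rightarrow>\<^sub>E UNIV" by (simp add: base_polyhedron_def)
  then show "decreasingly_minimal S (base_polyhedron S p \<inter> (S \<rightarrow>\<^sub>E \<int>)) m \<longleftrightarrow>
      (\<forall>i\<in>{1..q}. restrict m (A i) \<in> canonical_base S p i \<inter> canonical_box S p i)"
    unfolding decreasingly_minimal_iff using m
    unfolding direct_sum_def UN_sets by blast
qed

end
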